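(* Let $\mathbf{C}^\exists$ be the natural deduction system described in the context. Every deduction in $\mathbf{C}^\exists$ can be converted into a deduction in $\mathbf{C}^\exists$ in normal form (with the same conclusion).
   Context: The language is first-order: terms built from parameters $a,b,c,\dots$ (playing the role of free variables), constants and function symbols; formulas built from predicate symbols applied to terms by $\neg$ (unary), $\supset$, $\land$, $\lor$ and $\exists x$, where bound variables $x,y,z,\dots$ are distinct from parameters and never occur free. $A^x_t$ denotes the result of substituting the term $t$ for the variable $x$ in $A$ ($t$ free for $x$). Deductions are trees of formula occurrences whose leaves are assumptions; each assumption belongs to a numbered assumption class, and a rule discharging class $i$ (written $[X]^i$) discharges all assumptions of that class above the indicated premise. A single assumption $A$ is a deduction of $A$ from $A$. Rules of $\mathbf{C}^\exists$ ($C$ arbitrary): $\land I$: from $A$, $B$, and a deduction of $C$ from $[A\land B]$, infer $C$. $\land E$: from $A\land B$ and a deduction of $C$ from $[A]$, $[B]$, infer $C$. $\lor I$: from $A$ (or from $B$) and a deduction of $C$ from $[A\lor B]$, infer $C$. $\lor E$: from $A\lor B$, a deduction of $C$ from $[A]$, and a deduction of $C$ from $[B]$, infer $C$. $\supset I$: from $B$ and a deduction of $C$ from $[A\supset B]$, infer $C$. $TR$ (an introduction rule for $\supset$): from a deduction of $C$ from $[A]$ and a deduction of $C$ from $[A\supset B]$, infer $C$. $\supset E$: from $A\supset B$, $A$, and a deduction of $C$ from $[B]$, infer $C$. $\neg I$: from a deduction of $C$ from $[A]$ and a deduction of $C$ from $[\neg A]$, infer $C$. $\neg E$: from $\neg A$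 and $A$, infer $C$. $\exists I$: from $A^x_t$ and a deduction of $C$ from $[\exists x A]$, infer $C$. $\exists E$: from $\exists x A$ and a deduction of $C$ from $[A^x_a]$, infer $C$, provided the parameter $a$ does not occur in $\exists xA$, in $C$, or in any undischarged assumption of the deduction of $C$ other than those of the discharged class $[A^x_a]$. Introduction rules: $\land I,\lor I,\supset I,TR,\neg I,\exists I$; elimination rules: $\land E,\lor E,\supset E,\neg E,\exists E$. In elimination rules $A\land B, A\lor B, A\supset B,\neg A,\exists xA$ are the major premises; premises in the place of $C$ (in any rule) are arbitrary premises; the discharged $A\land B$, $A\lor B$, $A\supset B$ (in $\supset I$ and $TR$), $\neg A$ (in $\neg I$), $\exists xA$ (in $\exists I$) are the major assumptions discharged by the introduction rule. Convention: there is no vacuous discharge above arbitrary premises. A maximal formula is an occurrence of a formula with main operator $\ast$ that is both the major premise of an application of $\ast E$ and the major assumption discharged by an application of $\ast I$ (or of $TR$ when $\ast$ is $\supset$). A segment is a sequence $C_1,\dots,C_n$ of occurrences of the same formula such that for all $i<n$, $C_i$ is an arbitrary premise of a rule application whose conclusion is $C_{i+1}$, $C_n$ is not an arbitrary premise of any rule application, and either $n>1$, or $n\ge 1$ and $C_1$ is the conclusion of an application of $\neg E$. A maximal segment is a segment whose last formula is the major premise of an elimination rule. A deduction is in normal form if it contains neither maximal formulas nor maximal segments. *)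

theory Defs
  imports Main
begin

text \<open>Parameters and bound variables are two separate sorts, each indexed by the natural numbers.
  Constants are function symbols of arity \<open>0\<close>.\<close>

datatype 'f tm = Var nat | Par nat | Fun 'f "'f tm list"

datatype ('f, 'p) fm =
    Pred 'p "'f tm list"
  | Neg "('f, 'p) fm"
  | Imp "('f, 'p) fm" "('f, 'p) fm"
  | And "('f, 'p) fm" "('f, 'p) fm"
  | Or "('f, 'p) fm" "('f, 'p) fm"
  | Ex nat "('f, 'p) fm"

text \<open>A first-order language is given by its function and predicate symbols together with
  their arities.\<close>

record ('f, 'p) language =
  funs :: "('f \<times> nat) set"
  preds :: "('p \<times> nat) set"

text \<open>\<open>V\<close> is the set of variables bound by the quantifiers in whose scope the expression stands.\<close>

fun wf_tm :: "('f, 'p) language \<Rightarrow> nat set \<Rightarrow> 'f tm \<Rightarrow> bool" where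
  "wf_tm L V (Var x) = (x \<in> V)"
| "wf_tm L V (Par a) = True"
| "wf_tm L V (Fun f ts) = ((f, length ts) \<in> funs L \<and> (\<forall>t \<in> set ts. wf_tm L V t))"

primrec wf_fm :: "('f, 'p) language \<Rightarrow> nat set \<Rightarrow> ('f, 'p) fm \<Rightarrow> bool" where
  "wf_fm L V (Pred p ts) = ((p, length ts) \<in> preds L \<and> (\<forall>t \<in> set ts. wf_tm L V t))"
| "wf_fm L V (Neg A) = wf_fm L V A"
| "wf_fm L V (Imp A B) = (wf_fm L V A \<and> wf_fm L V B)"
| "wf_fm L V (And A B) = (wf_fm L V A \<and> wf_fm L V B)"
| "wf_fm L V (Or A B) = (wf_fm L V A \<and> wf_fm L V B)"
| "wf_fm L V (Ex x A) = wf_fm L (insert x V) A"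

text \<open>Variables never occur free, so the terms and formulas of the language proper are the
  following ones; in particular every term is free for every variable.\<close>

definition is_term :: "('f, 'p) language \<Rightarrow> 'f tm \<Rightarrow> bool" where
  "is_term L t \<longleftrightarrow> wf_tm L {} t"

definition is_formula :: "('f, 'p) language \<Rightarrow> ('f, 'p) fm \<Rightarrow> bool" where
  "is_formula L A \<longleftrightarrow> wf_fm L {} A"

fun params_tm :: "'f tm \<Rightarrow> nat set" where
  "params_tm (Var x) = {}"
| "params_tm (Par a) = {a}"
| "params_tm (Fun f ts) = (\<Union>t \<in> set ts. params_tm t)"

primrec params :: "('f, 'p) fm \<Rightarrow> nat set" where
  "params (Pred p ts) = (\<Union>t \<in> set ts. params_tm t)"
| "params (Neg A) = params A"
| "params (Imp A B) = params A \<union> params B"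
| "params (And A B) = params A \<union> params B"
| "params (Or A B) = params A \<union> params B"
| "params (Ex x A) = params A"

primrec subst_tm :: "nat \<Rightarrow> 'f tm \<Rightarrow> 'f tm \<Rightarrow> 'f tm" where
  "subst_tm x t (Var y) = (if y = x then t else Var y)"
| "subst_tm x t (Par a) = Par a"
| "subst_tm x t (Fun f ts) = Fun f (map (subst_tm x t) ts)"

text \<open>\<open>subst x t A\<close> is $A^x_t$.\<close>

primrec subst :: "nat \<Rightarrow> 'f tm \<Rightarrow> ('f, 'p) fm \<Rightarrow> ('f, 'p) fm" where
  "subst x t (Pred p ts) = Pred p (map (subst_tm x t) ts)"
| "subst x t (Neg A) = Neg (subst x t A)"
| "subst x t (Imp A B) = Imp (subst x t A) (subst x t B)"
| "subst x t (And A B) = And (subst x t A) (subst x t B)"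
| "subst x t (Or A B) = Or (subst x t A) (subst x t B)"
| "subst x t (Ex y A) = Ex y (if y = x then A else subst x t A)"

text \<open>An assumption class consists of the assumptions of one formula carrying one number.\<close>

type_synonym ('f, 'p) assm_class = "nat \<times> ('f, 'p) fm"

text \<open>The numbers in a rule are those of the classes it discharges, in the order of the
  premises above which they are discharged.\<close>

datatype ('f, 'p) rule =
    AndI "('f, 'p) fm" "('f, 'p) fm" nat
  | AndE "('f, 'p) fm" "('f, 'p) fm" nat nat
  | OrI1 "('f, 'p) fm" "('f, 'p) fm" nat
  | OrI2 "('f, 'p) fm" "('f, 'p) fm" nat
  | OrE "('f, 'p) fm" "('f, 'p) fm" nat nat
  | ImpI "('f, 'p) fm" "('f, 'p) fm" nat
  | TR "('f, 'p) fm" "('f, 'p) fm" nat nat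
  | ImpE "('f, 'p) fm" "('f, 'p) fm" nat
  | NegI "('f, 'p) fm" nat nat
  | NegE "('f, 'p) fm"
  | ExI nat "('f, 'p) fm" "'f tm" nat
  | ExE nat "('f, 'p) fm" nat nat

datatype role = Major | Minor | Arbitrary

datatype ('f, 'p) premise =
  Premise (role: role) (premise_fm: "('f, 'p) fm") (discharges: "('f, 'p) assm_class set")

text \<open>\<open>rule_premises r C\<close> lists the premises of an application of \<open>r\<close> with conclusion \<open>C\<close>; each comes
  with the classes that are discharged above it.\<close>

primrec rule_premises :: "('f, 'p) rule \<Rightarrow> ('f, 'p) fm \<Rightarrow> ('f, 'p) premise list" where
  "rule_premises (AndI A B i) C =
     [Premise Minor A {}, Premise Minor B {}, Premise Arbitrary C {(i, And A B)}]"
| "rule_premises (AndE A B i j) C =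
     [Premise Major (And A B) {}, Premise Arbitrary C {(i, A), (j, B)}]"
| "rule_premises (OrI1 A B i) C =
     [Premise Minor A {}, Premise Arbitrary C {(i, Or A B)}]"
| "rule_premises (OrI2 A B i) C =
     [Premise Minor B {}, Premise Arbitrary C {(i, Or A B)}]"
| "rule_premises (OrE A B i j) C =
     [Premise Major (Or A B) {}, Premise Arbitrary C {(i, A)}, Premise Arbitrary C {(j, B)}]"
| "rule_premises (ImpI A B i) C =
     [Premise Minor B {}, Premise Arbitrary C {(i, Imp A B)}]"
| "rule_premises (TR A B i j) C =
     [Premise Arbitrary C {(i, A)}, Premise Arbitrary C {(j, Imp A B)}]"
| "rule_premises (ImpE A B i) C =
     [Premise Major (Imp A B) {}, Premise Minor A {}, Premise Arbitrary C {(i, B)}]"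
| "rule_premises (NegI A i j) C =
     [Premise Arbitrary C {(i, A)}, Premise Arbitrary C {(j, Neg A)}]"
| "rule_premises (NegE A) C =
     [Premise Major (Neg A) {}, Premise Minor A {}]"
| "rule_premises (ExI x A t i) C =
     [Premise Minor (subst x t A) {}, Premise Arbitrary C {(i, Ex x A)}]"
| "rule_premises (ExE x A a i) C =
     [Premise Major (Ex x A) {}, Premise Arbitrary C {(i, subst x (Par a) A)}]"

text \<open>The class of major assumptions discharged by an introduction rule, preceded by the index
  of the premise above which it is discharged.\<close>

primrec major_assumption :: "('f, 'p) rule \<Rightarrow> (nat \<times> ('f, 'p) assm_class) option" where
  "major_assumption (AndI A B i) = Some (2, i, And A B)"
| "major_assumption (AndE A B i j) = None"
| "major_assumption (OrI1 A B i) = Some (1, i, Or A B)"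
| "major_assumption (OrI2 A B i) = Some (1, i, Or A B)"
| "major_assumption (OrE A B i j) = None"
| "major_assumption (ImpI A B i) = Some (1, i, Imp A B)"
| "major_assumption (TR A B i j) = Some (1, j, Imp A B)"
| "major_assumption (ImpE A B i) = None"
| "major_assumption (NegI A i j) = Some (1, j, Neg A)"
| "major_assumption (NegE A) = None"
| "major_assumption (ExI x A t i) = Some (1, i, Ex x A)"
| "major_assumption (ExE x A a i) = None"

datatype ('f, 'p) tree =
    Assm nat "('f, 'p) fm"
  | Infer "('f, 'p) rule" "('f, 'p) fm" "('f, 'p) tree list"

primrec concl :: "('f, 'p) tree \<Rightarrow> ('f, 'p) fm" where
  "concl (Assm i A) = A"
| "concl (Infer r C ds) = C"

primrec open_assms :: "('f, 'p) tree \<Rightarrow> ('f, 'p) assm_class set" where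
  "open_assms (Assm i A) = {(i, A)}"
| "open_assms (Infer r C ds) =
     \<Union> (set (map2 (\<lambda>U P. U - discharges P) (map open_assms ds) (rule_premises r C)))"

fun side_condition ::
  "('f, 'p) language \<Rightarrow> ('f, 'p) rule \<Rightarrow> ('f, 'p) fm \<Rightarrow> ('f, 'p) tree list \<Rightarrow> bool" where
  "side_condition L (ExI x A t i) C ds = is_term L t"
| "side_condition L (ExE x A a i) C ds =
     (a \<notin> params (Ex x A) \<and> a \<notin> params C \<and>
      (\<forall>(j, B) \<in> open_assms (ds ! 1) - {(i, subst x (Par a) A)}. a \<notin> params B))"
| "side_condition L _ C ds = True"

text \<open>The last premise of the second clause excludes vacuous discharge: above an arbitrary
  premise at least one assumption is discharged by the rule. Only conjunction elimination
  discharges two classes above the same premise, and one of them may be empty.\<close>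

inductive deduction :: "('f, 'p) language \<Rightarrow> ('f, 'p) tree \<Rightarrow> bool" for L where
  Assm: "is_formula L A \<Longrightarrow> deduction L (Assm i A)"
| Infer: "\<lbrakk> \<forall>d \<in> set ds. deduction L d;
            is_formula L C;
            map concl ds = map premise_fm (rule_premises r C);
            side_condition L r C ds;
            \<forall>k < length ds. role (rule_premises r C ! k) = Arbitrary \<longrightarrow>
              discharges (rule_premises r C ! k) \<inter> open_assms (ds ! k) \<noteq> {} \<rbrakk>
          \<Longrightarrow> deduction L (Infer r C ds)"

text \<open>Formula occurrences in a deduction are represented by their positions, that is, by the
  sequences of premise indices leading to them from the root.\<close>

type_synonym pos = "nat list"

fun subtree :: "('f, 'p) tree \<Rightarrow> pos \<Rightarrow> ('f, 'p) tree option" where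
  "subtree d [] = Some d"
| "subtree (Assm i A) (k # q) = None"
| "subtree (Infer r C ds) (k # q) = (if k < length ds then subtree (ds ! k) q else None)"

definition formula_at :: "('f, 'p) tree \<Rightarrow> pos \<Rightarrow> ('f, 'p) fm option" where
  "formula_at d q = map_option concl (subtree d q)"

definition inference_at ::
  "('f, 'p) tree \<Rightarrow> pos \<Rightarrow> ('f, 'p) rule \<Rightarrow> ('f, 'p) fm \<Rightarrow> bool" where
  "inference_at d p r C \<longleftrightarrow> (\<exists>ds. subtree d p = Some (Infer r C ds))"

text \<open>The occurrence at \<open>q\<close> is a premise with role \<open>\<rho>\<close> of the rule application whose conclusion
  is the occurrence at \<open>p\<close>.\<close>

definition premise_of :: "('f, 'p) tree \<Rightarrow> role \<Rightarrow> pos \<Rightarrow> pos \<Rightarrow> bool" where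
  "premise_of d \<rho> q p \<longleftrightarrow>
     (\<exists>k r C. q = p @ [k] \<and> subtree d q \<noteq> None \<and> inference_at d p r C \<and>
        role (rule_premises r C ! k) = \<rho>)"

text \<open>The rule application at \<open>p\<close> discharges class \<open>c\<close> above its premise number \<open>k\<close>.\<close>

definition discharges_class ::
  "('f, 'p) tree \<Rightarrow> pos \<Rightarrow> nat \<Rightarrow> ('f, 'p) assm_class \<Rightarrow> bool" where
  "discharges_class d p k c \<longleftrightarrow>
     (\<exists>r C. inference_at d p r C \<and> k < length (rule_premises r C) \<and> c \<in> discharges (rule_premises r C ! k))"

text \<open>The occurrence at \<open>q\<close> is an assumption of class \<open>c\<close> that is discharged by the rule
  application at \<open>p\<close>, above its premise number \<open>k\<close>. If several rule applications below \<open>q\<close>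
  discharge class \<open>c\<close>, the assumption is discharged by the first one met on the way down.\<close>

definition discharged_at ::
  "('f, 'p) tree \<Rightarrow> pos \<Rightarrow> ('f, 'p) assm_class \<Rightarrow> pos \<Rightarrow> nat \<Rightarrow> bool" where
  "discharged_at d q c p k \<longleftrightarrow>
     subtree d q = Some (Assm (fst c) (snd c)) \<and>
     (\<exists>s. q = p @ k # s \<and> discharges_class d p k c \<and>
        (\<forall>s1 k' s2. s = s1 @ k' # s2 \<longrightarrow> \<not> discharges_class d (p @ k # s1) k' c))"

definition maximal_formula :: "('f, 'p) tree \<Rightarrow> pos \<Rightarrow> bool" where
  "maximal_formula d q \<longleftrightarrow>
     (\<exists>p. premise_of d Major q p) \<and>
     (\<exists>p r C k c. inference_at d p r C \<and> major_assumption r = Some (k, c) \<and>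
        discharged_at d q c p k)"

definition segment :: "('f, 'p) tree \<Rightarrow> pos list \<Rightarrow> bool" where
  "segment d qs \<longleftrightarrow>
     qs \<noteq> [] \<and>
     (\<exists>F. \<forall>q \<in> set qs. formula_at d q = Some F) \<and>
     (\<forall>i. Suc i < length qs \<longrightarrow> premise_of d Arbitrary (qs ! i) (qs ! Suc i)) \<and>
     \<not> (\<exists>p. premise_of d Arbitrary (last qs) p) \<and>
     (length qs > 1 \<or> (\<exists>A C. inference_at d (hd qs) (NegE A) C))"

definition maximal_segment :: "('f, 'p) tree \<Rightarrow> pos list \<Rightarrow> bool" where
  "maximal_segment d qs \<longleftrightarrow> segment d qs \<and> (\<exists>p. premise_of d Major (last qs) p)"

definition normal :: "('f, 'p) tree \<Rightarrow> bool" where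
  "normal d \<longleftrightarrow> \<not> (\<exists>q. maximal_formula d q) \<and> \<not> (\<exists>qs. maximal_segment d qs)"

end

theory Submission
  imports Defs
begin

text \<open>
  The proof is semantic, in the style of Okada's phase-space proof of cut elimination.
  Fix the conclusion \<open>C\<close>. Every formula \<open>A\<close> gets two classes: an eliminable one, \<open>elim_class A\<close>,
  which alone may be a major premise, and \<open>intro_class A\<close>, which introduction rules discharge as
  their major assumption. A deduction whose major premises are all assumptions and which respects
  these two classes is normal. Sets of classes from which \<open>C\<close> has such a deduction form a pole;
  formulas are interpreted by biorthogonally closed sets of sets of classes so that
  \<open>{elim_class A} \<in> force A \<subseteq> {{intro_class A}}\<^sup>\<bottom>\<^sup>\<bottom>\<close>. The rules of the calculus, general in
  \<open>C\<close>, are exactly what these two inclusions need. All rules are sound for the interpretation, and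
  soundness of a deduction of \<open>C\<close> puts its open assumptions into the pole.
\<close>

section \<open>Substitution for parameters\<close>

primrec psubst_tm :: "(nat \<Rightarrow> 'f tm) \<Rightarrow> 'f tm \<Rightarrow> 'f tm" where
  "psubst_tm \<sigma> (Var x) = Var x"
| "psubst_tm \<sigma> (Par a) = \<sigma> a"
| "psubst_tm \<sigma> (Fun f ts) = Fun f (map (psubst_tm \<sigma>) ts)"

primrec psubst :: "(nat \<Rightarrow> 'f tm) \<Rightarrow> ('f, 'p) fm \<Rightarrow> ('f, 'p) fm" where
  "psubst \<sigma> (Pred p ts) = Pred p (map (psubst_tm \<sigma>) ts)"
| "psubst \<sigma> (Neg A) = Neg (psubst \<sigma> A)"
| "psubst \<sigma> (Imp A B) = Imp (psubst \<sigma> A) (psubst \<sigma> B)"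
| "psubst \<sigma> (And A B) = And (psubst \<sigma> A) (psubst \<sigma> B)"
| "psubst \<sigma> (Or A B) = Or (psubst \<sigma> A) (psubst \<sigma> B)"
| "psubst \<sigma> (Ex x A) = Ex x (psubst \<sigma> A)"

lemma psubst_tm_Par: "psubst_tm Par t = t"
  by (induction t) (auto intro: map_idI)

lemma psubst_Par: "psubst Par A = A"
  by (induction A) (auto simp: psubst_tm_Par intro: map_idI)

lemma psubst_tm_cong: "(\<And>a. a \<in> params_tm t \<Longrightarrow> \<sigma> a = \<tau> a) \<Longrightarrow> psubst_tm \<sigma> t = psubst_tm \<tau> t"
  by (induction t) auto

lemma psubst_cong: "(\<And>a. a \<in> params A \<Longrightarrow> \<sigma> a = \<tau> a) \<Longrightarrow> psubst \<sigma> A = psubst \<tau> A"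
  by (induction A) (auto intro!: psubst_tm_cong)

lemma subst_tm_fresh: "wf_tm L V t \<Longrightarrow> x \<notin> V \<Longrightarrow> subst_tm x u t = t"
  by (induction t) (auto intro: map_idI)

text \<open>The values of \<open>\<sigma>\<close> contain no variables, so the outer substitution
  for \<open>x\<close> leaves them alone.\<close>

lemma psubst_tm_subst_tm:
  assumes "\<And>a. is_term L (\<sigma> a)"
  shows "psubst_tm \<sigma> (subst_tm x t s) = subst_tm x (psubst_tm \<sigma> t) (psubst_tm \<sigma> s)"
  using assms by (induction s) (auto simp: is_term_def intro: subst_tm_fresh[symmetric])

lemma psubst_subst:
  assumes "\<And>a. is_term L (\<sigma> a)"
  shows "psubst \<sigma> (subst x t A) = subst x (psubst_tm \<sigma> t) (psubst \<sigma> A)"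
  by (induction A) (auto simp: psubst_tm_subst_tm[OF assms])

lemma is_term_psubst_tm:
  assumes "\<And>a. is_term L (\<sigma> a)" and "is_term L t"
  shows "is_term L (psubst_tm \<sigma> t)"
  using assms by (induction t) (auto simp: is_term_def)

lemma wf_tm_mono: "wf_tm L V t \<Longrightarrow> V \<subseteq> W \<Longrightarrow> wf_tm L W t"
  by (induction t) auto

lemma wf_tm_subst_tm: "wf_tm L V s \<Longrightarrow> wf_tm L {} t \<Longrightarrow> wf_tm L (V - {x}) (subst_tm x t s)"
  by (induction s) (auto intro: wf_tm_mono)

lemma wf_fm_subst: "wf_fm L V A \<Longrightarrow> wf_tm L {} t \<Longrightarrow> wf_fm L (V - {x}) (subst x t A)"
proof (induction A arbitrary: V)
  case (Ex y A)
  show ?case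
  proof (cases "y = x")
    case True
    then show ?thesis using Ex.prems by simp
  next
    case False
    then have "insert y V - {x} = insert y (V - {x})" by auto
    then show ?thesis using Ex.IH[of "insert y V"] Ex.prems False by simp
  qed
qed (auto intro: wf_tm_subst_tm)

lemma is_formula_subst: "is_formula L (Ex x A) \<Longrightarrow> is_term L t \<Longrightarrow> is_formula L (subst x t A)"
  using wf_fm_subst[of L "{x}" A t x] by (simp add: is_formula_def is_term_def)

lemma finite_params_tm: "finite (params_tm t)"
  by (induction t) auto

lemma finite_params: "finite (params A)"
  by (induction A) (auto simp: finite_params_tm)

text \<open>Terms are not counted, so all instances of the body of \<open>Ex x A\<close> lie below
  it; the recursion defining \<open>force\<close> terminates for this reason.\<close>

primrec complexity :: "('f, 'p) fm \<Rightarrow> nat" where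
  "complexity (Pred p ts) = 0"
| "complexity (Neg A) = Suc (complexity A)"
| "complexity (Imp A B) = Suc (complexity A + complexity B)"
| "complexity (And A B) = Suc (complexity A + complexity B)"
| "complexity (Or A B) = Suc (complexity A + complexity B)"
| "complexity (Ex x A) = Suc (complexity A)"

lemma complexity_subst: "complexity (subst x t A) = complexity A"
  by (induction A) auto

section \<open>Canonical deductions\<close>

text \<open>Eliminable classes are those of the form \<open>(f A, A)\<close>.\<close>

fun canonical :: "(('f, 'p) fm \<Rightarrow> nat) \<Rightarrow> ('f, 'p) tree \<Rightarrow> bool" where
  "canonical f (Assm i A) = True"
| "canonical f (Infer r C ds) =
     ((\<forall>d \<in> set ds. canonical f d) \<and>
      (\<forall>k < length ds. role (rule_premises r C ! k) = Major \<longrightarrow> (\<exists>A. ds ! k = Assm (f A) A)) \<and>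
      (\<forall>k i A. major_assumption r = Some (k, i, A) \<longrightarrow> i \<noteq> f A))"

lemma subtree_append: "subtree d (p @ q) = Option.bind (subtree d p) (\<lambda>d'. subtree d' q)"
  by (induction d p rule: subtree.induct) auto

lemma canonical_subtree: "canonical f d \<Longrightarrow> subtree d p = Some d' \<Longrightarrow> canonical f d'"
  by (induction d p rule: subtree.induct) (auto split: if_splits)

lemma canonical_major_premise:
  assumes "canonical f d" and "premise_of d Major q p"
  obtains A where "subtree d q = Some (Assm (f A) A)"
proof -
  from assms(2) obtain k r C ds where q: "q = p @ [k]" "subtree d q \<noteq> None"
    and p: "subtree d p = Some (Infer r C ds)" and r: "role (rule_premises r C ! k) = Major"
    by (auto simp: premise_of_def inference_at_def)
  have k: "k < length ds" "subtree d q = Some (ds ! k)"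
    using q p by (auto simp: subtree_append split: if_splits)
  then show thesis
    using canonical_subtree[OF assms(1) p] r that by auto
qed

text \<open>A maximal formula \<open>A\<close> would need the number \<open>f A\<close> as a major
  premise and a different one as a discharged major assumption. A maximal segment would end in a
  major premise, hence in a leaf, whereas the last member of a segment is always the conclusion of a
  rule: of the rule leading to it from its predecessor, or of \<open>NegE\<close>.\<close>

lemma canonical_normal:
  assumes "canonical f d"
  shows "normal d"
  unfolding normal_def
proof (intro conjI notI; elim exE)
  fix q
  assume "maximal_formula d q"
  then obtain p p' r C k c where "premise_of d Major q p" and "inference_at d p' r C"
    and m: "major_assumption r = Some (k, c)" and q: "subtree d q = Some (Assm (fst c) (snd c))"
    by (auto simp: maximal_formula_def discharged_at_def)
  moreover from this obtain ds where "subtree d p' = Some (Infer r C ds)"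
    by (auto simp: inference_at_def)
  ultimately show False
    using canonical_subtree[OF assms, of p'] canonical_major_premise[OF assms, of q p]
    by (cases c) fastforce
next
  fix qs
  assume "maximal_segment d qs"
  then obtain p where s: "segment d qs" and "premise_of d Major (last qs) p"
    by (auto simp: maximal_segment_def)
  then obtain A where leaf: "subtree d (last qs) = Some (Assm (f A) A)"
    using canonical_major_premise[OF assms] by metis
  have ne: "qs \<noteq> []" using s by (simp add: segment_def)
  show False
  proof (cases "length qs > 1")
    case True
    then have "premise_of d Arbitrary (qs ! (length qs - 2)) (qs ! Suc (length qs - 2))"
      using s by (auto simp: segment_def)
    moreover have "qs ! Suc (length qs - 2) = last qs"
      using True ne by (auto simp: last_conv_nth Suc_diff_Suc numeral_2_eq_2)
    ultimately show False
      using leaf by (auto simp: premise_of_def inference_at_def)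
  next
    case False
    then have "hd qs = last qs" using ne by (cases qs) auto
    then show False
      using False s leaf by (auto simp: segment_def inference_at_def)
  qed
qed

section \<open>The pole\<close>

locale canonical_deductions =
  fixes L :: "('f, 'p) language" and C :: "('f, 'p) fm" and f :: "('f, 'p) fm \<Rightarrow> nat"
  assumes formula_C: "is_formula L C"
begin

definition elim_class :: "('f, 'p) fm \<Rightarrow> ('f, 'p) assm_class" where
  "elim_class A = (f A, A)"

text \<open>Atoms are never major premises, so their two classes can be identified.\<close>

definition intro_class :: "('f, 'p) fm \<Rightarrow> ('f, 'p) assm_class" where
  "intro_class A = (case A of Pred p ts \<Rightarrow> f A | _ \<Rightarrow> Suc (f A), A)"

text \<open>Infinite sets are put into the pole so that the choice of a fresh parameter for \<open>\<exists>E\<close> needs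
  no separate finiteness bookkeeping.\<close>

definition derivable :: "('f, 'p) assm_class set \<Rightarrow> bool" where
  "derivable w \<longleftrightarrow> infinite w \<or>
     (\<exists>d. deduction L d \<and> canonical f d \<and> concl d = C \<and> open_assms d \<subseteq> w)"

lemma derivable_mono: "derivable v \<Longrightarrow> v \<subseteq> w \<Longrightarrow> derivable w"
  unfolding derivable_def using infinite_super by blast

lemma arbitrary_premise_fm:
  "P \<in> set (rule_premises r A) \<Longrightarrow> role P = Arbitrary \<Longrightarrow> premise_fm P = A"
  by (cases r) auto

text \<open>It suffices that the major and minor premises are assumptions of the appropriate class. An
  arbitrary premise above which nothing would be discharged is itself the wanted deduction.\<close>

lemma derivable_rule:
  assumes prem: "\<And>P. P \<in> set (rule_premises r C) \<Longrightarrow> is_formula L (premise_fm P) \<and>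
      (case role P of Major \<Rightarrow> elim_class (premise_fm P) \<in> w
       | Minor \<Rightarrow> intro_class (premise_fm P) \<in> w
       | Arbitrary \<Rightarrow> derivable (discharges P \<union> w))"
    and major: "\<And>k i A. major_assumption r = Some (k, i, A) \<Longrightarrow> i \<noteq> f A"
    and side: "\<And>ds. length ds = length (rule_premises r C) \<Longrightarrow>
      \<forall>k < length ds. open_assms (ds ! k) \<subseteq> discharges (rule_premises r C ! k) \<union> w \<Longrightarrow>
      side_condition L r C ds"
  shows "derivable w"
proof (rule ccontr)
  assume w: "\<not> derivable w"
  then have fin: "finite w" by (simp add: derivable_def)
  let ?Q = "\<lambda>P d. deduction L d \<and> canonical f d \<and> concl d = premise_fm P \<and>
    open_assms d \<subseteq> discharges P \<union> w \<and> (role P = Major \<longrightarrow> (\<exists>A. d = Assm (f A) A)) \<and>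
    (role P = Arbitrary \<longrightarrow> discharges P \<inter> open_assms d \<noteq> {})"
  have "\<exists>d. ?Q P d" if P: "P \<in> set (rule_premises r C)" for P
  proof (cases "role P")
    case Major
    then show ?thesis
      using prem[OF P]
      by (intro exI[of _ "Assm (f (premise_fm P)) (premise_fm P)"])
        (auto simp: elim_class_def intro: deduction.Assm)
  next
    case Minor
    then show ?thesis
      using prem[OF P]
      by (intro exI[of _ "Assm (fst (intro_class (premise_fm P))) (premise_fm P)"])
        (auto simp: intro_class_def intro: deduction.Assm)
  next
    case Arbitrary
    \<comment> \<open>Finiteness of \<open>discharges P \<union> w\<close> leaves only the disjunct
      of \<open>derivable\<close> that supplies a deduction.\<close>
    have "finite (discharges P)" using P by (cases r) auto
    then obtain d where d: "deduction L d" "canonical f d" "concl d = C"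
      "open_assms d \<subseteq> discharges P \<union> w"
      using prem[OF P] Arbitrary fin by (auto simp: derivable_def)
    with w have "discharges P \<inter> open_assms d \<noteq> {}"
      by (auto simp: derivable_def)
    with d show ?thesis
      using Arbitrary arbitrary_premise_fm[OF P] by auto
  qed
  then obtain D where D: "\<And>P. P \<in> set (rule_premises r C) \<Longrightarrow> ?Q P (D P)"
    by metis
  define ds where "ds = map D (rule_premises r C)"
  have nth: "?Q (rule_premises r C ! k) (ds ! k)" if "k < length ds" for k
    using D that by (auto simp: ds_def)
  have "deduction L (Infer r C ds)"
  proof (rule deduction.Infer)
    show "side_condition L r C ds"
      using nth by (intro side) (auto simp: ds_def)
  qed (use D nth formula_C in \<open>auto simp: ds_def\<close>)
  moreover have "canonical f (Infer r C ds)"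
    using D nth major by (auto simp: ds_def)
  moreover have "open_assms (Infer r C ds) \<subseteq> w"
    using nth by (fastforce simp: set_zip ds_def)
  ultimately have "derivable w"
    unfolding derivable_def by (metis concl.simps(2))
  with w show False ..
qed

section \<open>Closure of the pole under the individual rules\<close>

lemma derivable_intro_class: "derivable {intro_class C}"
  unfolding derivable_def
  by (rule disjI2, rule exI[of _ "Assm (fst (intro_class C)) C"])
    (auto simp: intro_class_def intro: deduction.Assm formula_C)

lemma elim_class_Pred: "elim_class (Pred p ts) = intro_class (Pred p ts)"
  by (simp add: elim_class_def intro_class_def)

lemmas class_defs = elim_class_def intro_class_def fm.case

text \<open>\<open>Suc\<close> keeps the discharged number apart from the eliminable one, as
  \<open>canonical\<close> demands of major assumptions. The other introduction rules follow the
  same pattern.\<close>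

lemma derivable_AndI:
  assumes "is_formula L (And A B)" and "derivable (insert (intro_class (And A B)) v)"
  shows "derivable (insert (intro_class A) (insert (intro_class B) v))"
  by (rule derivable_rule[of "AndI A B (Suc (f (And A B)))"])
    (use assms formula_C in
      \<open>auto simp: is_formula_def intro_class_def
          intro: derivable_mono[OF assms(2)[unfolded class_defs]]\<close>)

text \<open>The components are discharged under their eliminable numbers: they are not major
  assumptions, so they may be major premises higher up.\<close>

lemma derivable_AndE:
  assumes "is_formula L (And A B)" and "derivable (insert (elim_class A) (insert (elim_class B) v))"
  shows "derivable (insert (elim_class (And A B)) v)"
  by (rule derivable_rule[of "AndE A B (f A) (f B)"])
    (use assms formula_C in
      \<open>auto simp: is_formula_def elim_class_def
          intro: derivable_mono[OF assms(2)[unfolded class_defs]]\<close>)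

lemma derivable_OrI1:
  assumes "is_formula L (Or A B)" and "derivable (insert (intro_class (Or A B)) v)"
  shows "derivable (insert (intro_class A) v)"
  by (rule derivable_rule[of "OrI1 A B (Suc (f (Or A B)))"])
    (use assms formula_C in
      \<open>auto simp: is_formula_def intro_class_def
          intro: derivable_mono[OF assms(2)[unfolded class_defs]]\<close>)

lemma derivable_OrI2:
  assumes "is_formula L (Or A B)" and "derivable (insert (intro_class (Or A B)) v)"
  shows "derivable (insert (intro_class B) v)"
  by (rule derivable_rule[of "OrI2 A B (Suc (f (Or A B)))"])
    (use assms formula_C in
      \<open>auto simp: is_formula_def intro_class_def
          intro: derivable_mono[OF assms(2)[unfolded class_defs]]\<close>)

lemma derivable_OrE:
  assumes "is_formula L (Or A B)" and "derivable (insert (elim_class A) v)"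
    and "derivable (insert (elim_class B) v)"
  shows "derivable (insert (elim_class (Or A B)) v)"
  by (rule derivable_rule[of "OrE A B (f A) (f B)"])
    (use assms formula_C in
      \<open>auto simp: is_formula_def elim_class_def
          intro: derivable_mono[OF assms(2)[unfolded class_defs]]
            derivable_mono[OF assms(3)[unfolded class_defs]]\<close>)

lemma derivable_ImpI:
  assumes "is_formula L (Imp A B)" and "derivable (insert (intro_class (Imp A B)) v)"
  shows "derivable (insert (intro_class B) v)"
  by (rule derivable_rule[of "ImpI A B (Suc (f (Imp A B)))"])
    (use assms formula_C in
      \<open>auto simp: is_formula_def intro_class_def
          intro: derivable_mono[OF assms(2)[unfolded class_defs]]\<close>)

text \<open>Only the implication is a major assumption here, so \<open>A\<close> may take its
  eliminable class. Nothing is added to the context \<open>v\<close>: the rule is a classical case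
  distinction.\<close>

lemma derivable_TR:
  assumes "is_formula L (Imp A B)" and "derivable (insert (elim_class A) v)"
    and "derivable (insert (intro_class (Imp A B)) v)"
  shows "derivable v"
  by (rule derivable_rule[of "TR A B (f A) (Suc (f (Imp A B)))"])
    (use assms formula_C in
      \<open>auto simp: is_formula_def intro_class_def elim_class_def
          intro: derivable_mono[OF assms(2)[unfolded class_defs]]
            derivable_mono[OF assms(3)[unfolded class_defs]]\<close>)

lemma derivable_ImpE:
  assumes "is_formula L (Imp A B)" and "derivable (insert (elim_class B) v)"
  shows "derivable (insert (elim_class (Imp A B)) (insert (intro_class A) v))"
  by (rule derivable_rule[of "ImpE A B (f B)"])
    (use assms formula_C in
      \<open>auto simp: is_formula_def elim_class_def
          intro: derivable_mono[OF assms(2)[unfolded class_defs]]\<close>)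

lemma derivable_NegI:
  assumes "is_formula L (Neg A)" and "derivable (insert (elim_class A) v)"
    and "derivable (insert (intro_class (Neg A)) v)"
  shows "derivable v"
  by (rule derivable_rule[of "NegI A (f A) (Suc (f (Neg A)))"])
    (use assms formula_C in
      \<open>auto simp: is_formula_def intro_class_def elim_class_def
          intro: derivable_mono[OF assms(2)[unfolded class_defs]]
            derivable_mono[OF assms(3)[unfolded class_defs]]\<close>)

text \<open>Negation elimination has no arbitrary premise, so it reaches \<open>C\<close> at once,
  without a further context.\<close>

lemma derivable_NegE:
  assumes "is_formula L (Neg A)"
  shows "derivable {elim_class (Neg A), intro_class A}"
  by (rule derivable_rule[of "NegE A"]) (use assms in \<open>auto simp: is_formula_def\<close>)

lemma derivable_ExI:
  assumes "is_formula L (Ex x A)" and "is_term L t"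
    and "derivable (insert (intro_class (Ex x A)) v)"
  shows "derivable (insert (intro_class (subst x t A)) v)"
  by (rule derivable_rule[of "ExI x A t (Suc (f (Ex x A)))"])
    (use assms formula_C is_formula_subst[OF assms(1,2)] in
      \<open>auto simp: intro_class_def
          intro: derivable_mono[OF assms(3)[unfolded class_defs]]\<close>)

text \<open>All parameters are allowed in the hypothesis because the fresh one depends on
  \<open>v\<close>. Such a parameter exists for finite \<open>v\<close>; an infinite context is in
  the pole anyway.\<close>

lemma derivable_ExE:
  assumes A: "is_formula L (Ex x A)"
    and v: "\<And>a. derivable (insert (elim_class (subst x (Par a) A)) v)"
  shows "derivable (insert (elim_class (Ex x A)) v)"
proof (cases "finite v")
  case False
  then show ?thesis by (simp add: derivable_def)
next
  case True
  then have "finite (params (Ex x A) \<union> params C \<union> (\<Union>(i, B) \<in> v. params B))"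
    by (auto simp: finite_params)
  from ex_new_if_finite[OF infinite_UNIV_nat this]
  obtain a where a: "a \<notin> params (Ex x A) \<union> params C \<union> (\<Union>(i, B) \<in> v. params B)" ..
  let ?A = "subst x (Par a) A"
  have A': "is_formula L ?A" using is_formula_subst[OF A] by (simp add: is_term_def)
  show ?thesis
  proof (rule derivable_rule[of "ExE x A a (f ?A)"])
    fix P assume "P \<in> set (rule_premises (ExE x A a (f ?A)) C)"
    then show "is_formula L (premise_fm P) \<and>
        (case role P of Major \<Rightarrow> elim_class (premise_fm P) \<in> insert (elim_class (Ex x A)) v
         | Minor \<Rightarrow> intro_class (premise_fm P) \<in> insert (elim_class (Ex x A)) v
         | Arbitrary \<Rightarrow> derivable (discharges P \<union> insert (elim_class (Ex x A)) v))"
      using A A' formula_C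
      by (auto simp: elim_class_def intro: derivable_mono[OF v[of a, unfolded class_defs]])
  next
    fix ds :: "('f, 'p) tree list"
    assume "length ds = length (rule_premises (ExE x A a (f ?A)) C)"
      and "\<forall>k < length ds. open_assms (ds ! k) \<subseteq>
        discharges (rule_premises (ExE x A a (f ?A)) C ! k) \<union> insert (elim_class (Ex x A)) v"
    then have "open_assms (ds ! 1) - {(f ?A, ?A)} \<subseteq> insert (elim_class (Ex x A)) v"
      by (auto dest!: spec[of _ 1])
    moreover have "\<forall>(i, B) \<in> insert (elim_class (Ex x A)) v. a \<notin> params B"
      using a by (auto simp: elim_class_def)
    ultimately show "side_condition L (ExE x A a (f ?A)) C ds"
      using a by auto
  qed simp
qed

section \<open>Interpretation of formulas\<close>

definition perp :: "('f, 'p) assm_class set set \<Rightarrow> ('f, 'p) assm_class set set" where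
  "perp X = {k. \<forall>x \<in> X. derivable (x \<union> k)}"

lemma perpI: "(\<And>x. x \<in> X \<Longrightarrow> derivable (x \<union> k)) \<Longrightarrow> k \<in> perp X"
  by (simp add: perp_def)

lemma perpD: "k \<in> perp X \<Longrightarrow> x \<in> X \<Longrightarrow> x \<union> k \<subseteq> w \<Longrightarrow> derivable w"
  by (auto simp: perp_def intro: derivable_mono)

lemma perp_upward: "k \<in> perp X \<Longrightarrow> k \<subseteq> k' \<Longrightarrow> k' \<in> perp X"
  by (auto intro!: perpI elim!: perpD)

lemma subset_perp_perp: "X \<subseteq> perp (perp X)"
  by (auto intro!: perpI elim!: perpD)

lemma perp_anti: "X \<subseteq> Y \<Longrightarrow> perp Y \<subseteq> perp X"
  by (auto simp: perp_def)

lemma perp_perp_perp: "perp (perp (perp X)) = perp X"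
  using perp_anti[OF subset_perp_perp[of X]] subset_perp_perp[of "perp X"] by blast

text \<open>Semantic elimination: for a closed target, an element of the double orthogonal may be
  replaced by a generator. A test \<open>k\<close> against \<open>Y\<close>, joined with
  \<open>w\<close>, becomes a test against \<open>X\<close>, to which \<open>w\<close> itself is
  then applied.\<close>

lemma perp_perp_elim:
  assumes w: "w \<in> perp (perp X)" and Y: "perp (perp Y) = Y" and XY: "\<And>x. x \<in> X \<Longrightarrow> w \<union> x \<in> Y"
  shows "w \<in> Y"
proof -
  have "w \<in> perp (perp Y)"
  proof (rule perpI)
    fix k assume k: "k \<in> perp Y"
    have "k \<union> w \<in> perp X"
    proof (rule perpI)
      fix x assume "x \<in> X"
      then show "derivable (x \<union> (k \<union> w))" by (blast intro: perpD[OF k XY])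
    qed
    then show "derivable (k \<union> w)" using perpD[OF w] by blast
  qed
  with Y show ?thesis by simp
qed

text \<open>Every value is an orthogonal and therefore closed. Conjunction, disjunction and
  existence are closures of their generators; an implication is tested by an element forcing
  \<open>A\<close> together with a test against \<open>B\<close>.\<close>

function force :: "('f, 'p) fm \<Rightarrow> ('f, 'p) assm_class set set" where
  "force (Pred p ts) = perp (perp {{elim_class (Pred p ts)}})"
| "force (Neg A) = perp (force A)"
| "force (Imp A B) = perp {x \<union> k | x k. x \<in> force A \<and> k \<in> perp (force B)}"
| "force (And A B) = perp (perp {x \<union> y | x y. x \<in> force A \<and> y \<in> force B})"
| "force (Or A B) = perp (perp (force A \<union> force B))"
| "force (Ex x A) = perp (perp (\<Union>t \<in> {t. is_term L t}. force (subst x t A)))"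
  by pat_completeness auto
termination
  by (relation "measure complexity") (auto simp: complexity_subst)

lemma force_closed: "perp (perp (force A)) = force A"
  by (cases A) (simp_all add: perp_perp_perp)

lemma force_upward: "w \<in> force A \<Longrightarrow> w \<subseteq> w' \<Longrightarrow> w' \<in> force A"
  using perp_upward force_closed by metis

lemma forceI: "(\<And>k. k \<in> perp (force A) \<Longrightarrow> derivable (w \<union> k)) \<Longrightarrow> w \<in> force A"
  using perpI[of "perp (force A)" w] by (simp add: force_closed Un_commute)

text \<open>Semantic cut: the assumption \<open>intro_class A\<close> is replaced by any context
  forcing \<open>A\<close>.\<close>

lemma force_intro_class:
  assumes "force A \<subseteq> perp (perp {{intro_class A}})" and "w \<in> force A"
    and "derivable (insert (intro_class A) v)"
  shows "derivable (w \<union> v)"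
proof -
  have "v \<in> perp {{intro_class A}}" using assms(3) by (simp add: perp_def)
  moreover have "w \<in> perp (perp {{intro_class A}})" using assms(1,2) ..
  ultimately show ?thesis by (auto intro: perpD)
qed

text \<open>Upper bounds for a closure need checking on generators only.\<close>

lemma perp_perp_least: "X \<subseteq> perp (perp Y) \<Longrightarrow> perp (perp X) \<subseteq> perp (perp Y)"
  by (metis perp_anti perp_perp_perp)

text \<open>For each connective the lower bound comes from its elimination rule and the upper bound
  from its introduction rules. The induction follows \<open>force\<close>, so for
  \<open>Ex x A\<close> the hypothesis covers every instance by a term.\<close>

lemma force_bounds:
  "is_formula L A \<Longrightarrow> {elim_class A} \<in> force A \<and> force A \<subseteq> perp (perp {{intro_class A}})"
proof (induction A rule: force.induct)
  case (1 p ts)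
  then show ?case using subset_perp_perp by (auto simp: elim_class_Pred)
next
  case (2 A)
  then have A: "{elim_class A} \<in> force A" "force A \<subseteq> perp (perp {{intro_class A}})"
    by (auto simp: is_formula_def)
  have "{elim_class (Neg A)} \<in> force (Neg A)"
    using force_intro_class[OF A(2)] derivable_NegE[OF 2(2)]
    by (auto intro!: perpI simp: insert_commute)
  moreover have "w \<in> perp (perp {{intro_class (Neg A)}})" if w: "w \<in> force (Neg A)" for w
  proof (rule perpI)
    fix v assume "v \<in> perp {{intro_class (Neg A)}}"
    then have "derivable (insert (intro_class (Neg A)) (v \<union> w))"
      by (rule perpD) auto
    moreover have "derivable (insert (elim_class A) (v \<union> w))"
      using w A(1) by (auto elim!: perpD)
    ultimately show "derivable (v \<union> w)" using derivable_NegI[OF 2(2)] by blast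
  qed
  ultimately show ?case by blast
next
  case (3 A B)
  then have A: "{elim_class A} \<in> force A" "force A \<subseteq> perp (perp {{intro_class A}})"
    and B: "{elim_class B} \<in> force B" "force B \<subseteq> perp (perp {{intro_class B}})"
    by (auto simp: is_formula_def)
  have "derivable (insert (elim_class (Imp A B)) (x \<union> k))"
    if "x \<in> force A" "k \<in> perp (force B)" for x k
  proof -
    have "derivable (insert (elim_class B) k)"
      by (rule perpD[OF that(2) B(1)]) simp
    from derivable_ImpE[OF 3(3) this]
    have "derivable (insert (intro_class A) (insert (elim_class (Imp A B)) k))"
      by (simp add: insert_commute)
    then show ?thesis
      using force_intro_class[OF A(2) that(1)] by fastforce
  qed
  then have "{elim_class (Imp A B)} \<in> force (Imp A B)"
    by (auto intro!: perpI)
  moreover have "w \<in> perp (perp {{intro_class (Imp A B)}})" if w: "w \<in> force (Imp A B)" for w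
  proof (rule perpI)
    fix v assume v: "v \<in> perp {{intro_class (Imp A B)}}"
    then have "derivable (insert (intro_class (Imp A B)) v)"
      by (rule perpD) auto
    \<comment> \<open>\<open>ImpI\<close> makes \<open>v\<close> a test against \<open>B\<close>.
      Together with \<open>{elim_class A}\<close> it is a test for the implication forced by
      \<open>w\<close>, and \<open>TR\<close> then joins the two cases.\<close>
    then have "v \<in> perp {{intro_class B}}"
      using derivable_ImpI[OF 3(3)] by (auto intro: perpI)
    then have "v \<in> perp (force B)"
      using perp_anti[OF B(2)] by (auto simp: perp_perp_perp)
    then have "derivable (insert (elim_class A) (v \<union> w))"
      using A(1) w by (intro perpD[of w _ "{elim_class A} \<union> v"]) auto
    moreover have "derivable (insert (intro_class (Imp A B)) (v \<union> w))"
      using v by (rule perpD) auto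
    ultimately show "derivable (v \<union> w)" using derivable_TR[OF 3(3)] by blast
  qed
  ultimately show ?case by blast
next
  case (4 A B)
  then have A: "{elim_class A} \<in> force A" "force A \<subseteq> perp (perp {{intro_class A}})"
    and B: "{elim_class B} \<in> force B" "force B \<subseteq> perp (perp {{intro_class B}})"
    by (auto simp: is_formula_def)
  let ?X = "{x \<union> y | x y. x \<in> force A \<and> y \<in> force B}"
  have "{elim_class (And A B)} \<in> perp (perp ?X)"
  proof (rule perpI)
    fix v assume v: "v \<in> perp ?X"
    have "{elim_class A} \<union> {elim_class B} \<in> ?X" using A(1) B(1) by blast
    then have "derivable (insert (elim_class A) (insert (elim_class B) v))"
      by (rule perpD[OF v]) auto
    then show "derivable (v \<union> {elim_class (And A B)})"
      using derivable_AndE[OF 4(3)] by simp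
  qed
  moreover have "?X \<subseteq> perp (perp {{intro_class (And A B)}})"
  proof (clarify, rule perpI)
    fix x y v assume x: "x \<in> force A" and y: "y \<in> force B"
      and v: "v \<in> perp {{intro_class (And A B)}}"
    from v have "derivable (insert (intro_class (And A B)) v)"
      by (simp add: perp_def)
    from force_intro_class[OF A(2) x derivable_AndI[OF 4(3) this]]
    have "derivable (insert (intro_class B) (x \<union> v))" by simp
    from force_intro_class[OF B(2) y this] show "derivable (v \<union> (x \<union> y))"
      by (simp add: Un_ac)
  qed
  ultimately show ?case using perp_perp_least by simp
next
  case (5 A B)
  then have A: "{elim_class A} \<in> force A" "force A \<subseteq> perp (perp {{intro_class A}})"
    and B: "{elim_class B} \<in> force B" "force B \<subseteq> perp (perp {{intro_class B}})"
    by (auto simp: is_formula_def)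
  have "{elim_class (Or A B)} \<in> force (Or A B)"
  proof (simp only: force.simps, rule perpI)
    fix v assume v: "v \<in> perp (force A \<union> force B)"
    have "derivable (insert (elim_class A) v)" "derivable (insert (elim_class B) v)"
      using A(1) B(1) by (auto intro: perpD[OF v])
    then show "derivable (v \<union> {elim_class (Or A B)})"
      using derivable_OrE[OF 5(3)] by simp
  qed
  moreover have "force A \<union> force B \<subseteq> perp (perp {{intro_class (Or A B)}})"
  proof (rule subsetI, rule perpI)
    fix x v assume x: "x \<in> force A \<union> force B" and v: "v \<in> perp {{intro_class (Or A B)}}"
    from v have "derivable (insert (intro_class (Or A B)) v)"
      by (simp add: perp_def)
    from derivable_OrI1[OF 5(3) this] derivable_OrI2[OF 5(3) this] x
    show "derivable (v \<union> x)"
      using force_intro_class[OF A(2), of x v] force_intro_class[OF B(2), of x v]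
      by (auto simp: Un_commute)
  qed
  ultimately show ?case using perp_perp_least by simp
next
  case (6 x A)
  have A: "{elim_class (subst x t A)} \<in> force (subst x t A)"
    "force (subst x t A) \<subseteq> perp (perp {{intro_class (subst x t A)}})" if "is_term L t" for t
    using 6(1)[of t] is_formula_subst[OF 6(2) that] that by auto
  let ?X = "\<Union>t \<in> {t. is_term L t}. force (subst x t A)"
  have "{elim_class (Ex x A)} \<in> force (Ex x A)"
  proof (simp only: force.simps, rule perpI)
    fix v assume v: "v \<in> perp ?X"
    \<comment> \<open>Parameters are terms, so \<open>?X\<close> contains the eliminable class of
      every parameter instance, which is what \<open>derivable_ExE\<close> asks for.\<close>
    have "derivable (insert (elim_class (subst x (Par a) A)) v)" for a
      by (rule perpD[OF v, of "{elim_class (subst x (Par a) A)}"])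
        (use A[of "Par a"] in \<open>auto simp: is_term_def intro!: exI[of _ "Par a"]\<close>)
    then show "derivable (v \<union> {elim_class (Ex x A)})"
      using derivable_ExE[OF 6(2)] by simp
  qed
  moreover have "?X \<subseteq> perp (perp {{intro_class (Ex x A)}})"
  proof (clarify, rule perpI)
    fix t y v assume t: "is_term L t" and y: "y \<in> force (subst x t A)"
      and v: "v \<in> perp {{intro_class (Ex x A)}}"
    from v have "derivable (insert (intro_class (Ex x A)) v)"
      by (simp add: perp_def)
    from derivable_ExI[OF 6(2) t this] show "derivable (v \<union> y)"
      using force_intro_class[OF A(2)[OF t] y] by (simp add: Un_commute)
  qed
  ultimately show ?case using perp_perp_least by simp
qed

section \<open>Soundness\<close>

text \<open>Both \<open>w\<close> and \<open>\<sigma>\<close> vary in the induction: discharged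
  assumptions enlarge the context, and \<open>ExE\<close> changes the value of its
  parameter.\<close>

lemma force_deduction:
  assumes "deduction L d" and "\<And>a. is_term L (\<sigma> a)"
    and "\<And>i B. (i, B) \<in> open_assms d \<Longrightarrow> w \<in> force (psubst \<sigma> B)"
  shows "w \<in> force (psubst \<sigma> (concl d))"
  using assms
proof (induction d arbitrary: \<sigma> w)
  case (Assm A i)
  then show ?case by auto
next
  case (Infer ds D r)
  let ?D = "psubst \<sigma> D"
  note \<sigma> = Infer.prems(1)
  \<comment> \<open>Uniform induction hypothesis: context and substitution may change, provided that
    undischarged assumptions keep their instances and discharged ones are forced by the new
    context.\<close>
  have prem: "w' \<in> force (psubst \<sigma>' (premise_fm (rule_premises r D ! k)))"
    if k: "k < length (rule_premises r D)" and \<sigma>': "\<And>a. is_term L (\<sigma>' a)" and w: "w \<subseteq> w'"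
      and old: "\<And>i B. (i, B) \<in> open_assms (ds ! k) - discharges (rule_premises r D ! k) \<Longrightarrow>
        psubst \<sigma>' B = psubst \<sigma> B"
      and new: "\<And>i B. (i, B) \<in> discharges (rule_premises r D ! k) \<Longrightarrow> w' \<in> force (psubst \<sigma>' B)"
    for k w' \<sigma>'
  proof -
    have len: "length ds = length (rule_premises r D)"
      using Infer.hyps(2) map_eq_imp_length_eq by blast
    have "w' \<in> force (psubst \<sigma>' (concl (ds ! k)))"
    proof (rule Infer.IH[rule_format, THEN conjunct2, rule_format])
      show "ds ! k \<in> set ds" using k len by simp
      show "is_term L (\<sigma>' a)" for a by (rule \<sigma>')
      fix i B assume B: "(i, B) \<in> open_assms (ds ! k)"
      show "w' \<in> force (psubst \<sigma>' B)"
      proof (cases "(i, B) \<in> discharges (rule_premises r D ! k)")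
        case True
        then show ?thesis by (rule new)
      next
        case False
        then have "(i, B) \<in> open_assms (Infer r D ds)"
          using B k len by (force simp: set_zip)
        then have "w \<in> force (psubst \<sigma> B)" by (rule Infer.prems(2))
        then show ?thesis
          using old[of i B] B False w by (auto intro: force_upward)
      qed
    qed
    moreover have "concl (ds ! k) = premise_fm (rule_premises r D ! k)"
      using Infer.hyps(2) k len by (metis nth_map)
    ultimately show ?thesis by simp
  qed
  note prem\<sigma> = prem[OF _ \<sigma> _ refl]
  have "w \<in> force ?D"
  proof (cases r)
    case (AndI A B i)
    have "w \<in> force (psubst \<sigma> A)" "w \<in> force (psubst \<sigma> B)"
      using prem\<sigma>[of 0 w] prem\<sigma>[of 1 w] by (auto simp: AndI)
    then have "w \<in> {x \<union> y | x y. x \<in> force (psubst \<sigma> A) \<and> y \<in> force (psubst \<sigma> B)}"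
      by blast
    then have "w \<in> force (psubst \<sigma> (And A B))"
      unfolding psubst.simps force.simps by (rule subset_perp_perp[THEN subsetD])
    then show ?thesis using prem\<sigma>[of 2 w] by (auto simp: AndI)
  next
    case (AndE A B i j)
    have "w \<in> force (psubst \<sigma> (And A B))" using prem\<sigma>[of 0 w] by (auto simp: AndE)
    then show ?thesis unfolding psubst.simps force.simps
    proof (rule perp_perp_elim[OF _ force_closed], clarify)
      fix x y assume "x \<in> force (psubst \<sigma> A)" "y \<in> force (psubst \<sigma> B)"
      then show "w \<union> (x \<union> y) \<in> force ?D"
        using prem\<sigma>[of 1 "w \<union> (x \<union> y)"] by (auto simp: AndE intro: force_upward)
    qed
  next
    case (OrI1 A B i)
    have "w \<in> force (psubst \<sigma> A)" using prem\<sigma>[of 0 w] by (auto simp: OrI1)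
    then have "w \<in> force (psubst \<sigma> (Or A B))" by (auto intro: subset_perp_perp[THEN subsetD])
    then show ?thesis using prem\<sigma>[of 1 w] by (auto simp: OrI1)
  next
    case (OrI2 A B i)
    have "w \<in> force (psubst \<sigma> B)" using prem\<sigma>[of 0 w] by (auto simp: OrI2)
    then have "w \<in> force (psubst \<sigma> (Or A B))" by (auto intro: subset_perp_perp[THEN subsetD])
    then show ?thesis using prem\<sigma>[of 1 w] by (auto simp: OrI2)
  next
    case (OrE A B i j)
    have "w \<in> force (psubst \<sigma> (Or A B))" using prem\<sigma>[of 0 w] by (auto simp: OrE)
    then show ?thesis unfolding psubst.simps force.simps
    proof (rule perp_perp_elim[OF _ force_closed])
      fix x assume "x \<in> force (psubst \<sigma> A) \<union> force (psubst \<sigma> B)"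
      then show "w \<union> x \<in> force ?D"
        using prem\<sigma>[of 1 "w \<union> x"] prem\<sigma>[of 2 "w \<union> x"] by (auto simp: OrE intro: force_upward)
    qed
  next
    case (ImpI A B i)
    have "w \<in> force (psubst \<sigma> B)" using prem\<sigma>[of 0 w] by (auto simp: ImpI)
    then have "w \<in> force (psubst \<sigma> (Imp A B))" by (auto intro!: perpI elim!: perpD)
    then show ?thesis using prem\<sigma>[of 1 w] by (auto simp: ImpI)
  next
    case (TR A B i j)
    show ?thesis
    proof (rule forceI)
      fix k assume k: "k \<in> perp (force ?D)"
      \<comment> \<open>By the first premise \<open>w \<union> x\<close> forces the conclusion, so
        \<open>k\<close> succeeds against it whatever the test \<open>l\<close> against
        \<open>B\<close> is. Hence \<open>w \<union> k\<close> forces the implication; the second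
        premise applies, and \<open>k\<close> is used once more.\<close>
      have "derivable (x \<union> l \<union> (w \<union> k))" if "x \<in> force (psubst \<sigma> A)" for x l
        using prem\<sigma>[of 0 "w \<union> x"] that
        by (intro perpD[OF k, of "w \<union> x"]) (auto simp: TR intro: force_upward)
      then have "w \<union> k \<in> force (psubst \<sigma> (Imp A B))"
        by (auto intro!: perpI)
      then have "w \<union> k \<in> force ?D" using prem\<sigma>[of 1 "w \<union> k"] by (auto simp: TR)
      then show "derivable (w \<union> k)" using perpD[OF k] by blast
    qed
  next
    case (ImpE A B i)
    have AB: "w \<in> force (psubst \<sigma> (Imp A B))" and A: "w \<in> force (psubst \<sigma> A)"
      using prem\<sigma>[of 0 w] prem\<sigma>[of 1 w] by (auto simp: ImpE)
    show ?thesis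
    proof (rule forceI)
      fix k assume k: "k \<in> perp (force ?D)"
      have "w \<union> k \<in> perp (force (psubst \<sigma> B))"
      proof (rule perpI)
        fix x assume "x \<in> force (psubst \<sigma> B)"
        then show "derivable (x \<union> (w \<union> k))"
          using prem\<sigma>[of 2 "w \<union> x"]
          by (intro perpD[OF k, of "w \<union> x"]) (auto simp: ImpE intro: force_upward)
      qed
      \<comment> \<open>Here \<open>w\<close> serves both as the implication and as its argument;
        idempotence of union merges the copies.\<close>
      with AB A show "derivable (w \<union> k)"
        by (auto elim!: perpD[where x = "w \<union> (w \<union> k)"])
    qed
  next
    case (NegI A i j)
    show ?thesis
    proof (rule forceI)
      fix k assume k: "k \<in> perp (force ?D)"
      have "derivable (x \<union> (w \<union> k))" if "x \<in> force (psubst \<sigma> A)" for x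
        using prem\<sigma>[of 0 "w \<union> x"] that
        by (intro perpD[OF k, of "w \<union> x"]) (auto simp: NegI intro: force_upward)
      then have "w \<union> k \<in> force (psubst \<sigma> (Neg A))"
        by (auto intro!: perpI)
      then have "w \<union> k \<in> force ?D" using prem\<sigma>[of 1 "w \<union> k"] by (auto simp: NegI)
      then show "derivable (w \<union> k)" using perpD[OF k] by blast
    qed
  next
    case (NegE A)
    have "w \<in> perp (force (psubst \<sigma> A))" "w \<in> force (psubst \<sigma> A)"
      using prem\<sigma>[of 0 w] prem\<sigma>[of 1 w] by (auto simp: NegE)
    \<comment> \<open>Tested against itself, \<open>w\<close> lies in the pole and so forces every
      formula.\<close>
    then have "derivable (w \<union> k)" for k by (rule perpD) auto
    then show ?thesis by (rule forceI)
  next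
    case (ExI x A t i)
    have "is_term L t" using Infer.hyps(3) by (simp add: ExI)
    then have "is_term L (psubst_tm \<sigma> t)" by (rule is_term_psubst_tm[OF \<sigma>])
    moreover have "w \<in> force (subst x (psubst_tm \<sigma> t) (psubst \<sigma> A))"
      using prem\<sigma>[of 0 w] by (auto simp: ExI psubst_subst[OF \<sigma>])
    ultimately have "w \<in> force (psubst \<sigma> (Ex x A))"
      by (auto intro!: subset_perp_perp[THEN subsetD])
    then show ?thesis using prem\<sigma>[of 1 w] by (auto simp: ExI)
  next
    case (ExE x A a i)
    have side: "a \<notin> params A" "a \<notin> params D"
      "\<And>j B. (j, B) \<in> open_assms (ds ! 1) - {(i, subst x (Par a) A)} \<Longrightarrow> a \<notin> params B"
      using Infer.hyps(3) by (auto simp: ExE)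
    have "w \<in> force (psubst \<sigma> (Ex x A))" using prem\<sigma>[of 0 w] by (auto simp: ExE)
    then show ?thesis unfolding psubst.simps force.simps
    proof (rule perp_perp_elim[OF _ force_closed], clarify)
      fix t y assume t: "is_term L t" and y: "y \<in> force (subst x t (psubst \<sigma> A))"
      \<comment> \<open>The generator provides an arbitrary term \<open>t\<close> as witness, which
        becomes the value of the eigenparameter. By the side condition this affects neither
        \<open>A\<close>, nor the conclusion, nor the assumptions left open.\<close>
      let ?\<sigma> = "\<sigma>(a := t)"
      have \<sigma>': "is_term L (?\<sigma> b)" for b using \<sigma> t by simp
      have fresh: "psubst ?\<sigma> B = psubst \<sigma> B" if "a \<notin> params B" for B :: "('f, 'p) fm"
        using that by (intro psubst_cong) auto
      have "psubst ?\<sigma> (subst x (Par a) A) = subst x t (psubst \<sigma> A)"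
        using psubst_subst[of L ?\<sigma> x "Par a" A, OF \<sigma>'] fresh[OF side(1)] by simp
      then have "w \<union> y \<in> force (psubst ?\<sigma> D)"
        using prem[of 1 ?\<sigma> "w \<union> y", OF _ \<sigma>'] side(3) fresh y
        by (auto simp: ExE intro: force_upward)
      then show "w \<union> y \<in> force ?D" using fresh[OF side(2)] by simp
    qed
  qed
  then show ?case by simp
qed

end

section \<open>Extraction of the normal deduction\<close>

lemma is_formula_concl: "deduction L d \<Longrightarrow> is_formula L (concl d)"
  by (cases rule: deduction.cases) auto

lemma finite_open_assms: "finite (open_assms d)"
  by (induction d) (auto simp: set_zip)

lemma is_formula_open_assms:
  "deduction L d \<Longrightarrow> (i, A) \<in> open_assms d \<Longrightarrow> is_formula L A"
  by (induction d rule: deduction.induct) (fastforce simp: set_zip)+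

theorem theorem4:
  fixes L :: "('f, 'p) language" and d :: "('f, 'p) tree"
  assumes "deduction L d"
  shows "\<exists>d'. deduction L d' \<and> normal d' \<and> concl d' = concl d \<and> open_assms d' \<subseteq> open_assms d"
proof -
  \<comment> \<open>For each formula open in \<open>d\<close>, one of its open classes is made the
    eliminable one; \<open>open_assms d\<close> then contains \<open>elim_class B\<close> for every
    open \<open>B\<close>, and so forces it.\<close>
  define f where "f A = (SOME i. (i, A) \<in> open_assms d)" for A
  have f: "(f A, A) \<in> open_assms d" if "(i, A) \<in> open_assms d" for i A
    unfolding f_def using that by (rule someI)
  interpret canonical_deductions L "concl d" f
    by unfold_locales (rule is_formula_concl[OF assms])
  have "open_assms d \<in> force (psubst Par B)" if B: "(i, B) \<in> open_assms d" for i B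
  proof -
    have "{elim_class B} \<in> force B"
      using force_bounds is_formula_open_assms[OF assms B] by blast
    then show ?thesis
      using f[OF B] by (auto simp: psubst_Par elim_class_def intro: force_upward)
  qed
  then have "open_assms d \<in> force (concl d)"
    using force_deduction[OF assms, of Par "open_assms d"] by (simp add: psubst_Par is_term_def)
  \<comment> \<open>The assumption of \<open>concl d\<close> is a deduction of itself, so the cut
    applies with empty \<open>v\<close>.\<close>
  then have "derivable (open_assms d \<union> {})"
    using force_intro_class[of "concl d"] force_bounds[OF formula_C] derivable_intro_class by blast
  then obtain d' where "deduction L d'" "canonical f d'" "concl d' = concl d"
    "open_assms d' \<subseteq> open_assms d"
    using finite_open_assms by (auto simp: derivable_def)
  then show ?thesis using canonical_normal by blast
qed

end
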